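(* Let $\mathcal{A} := (A, [\,,\,], [\,,\,,\,], \alpha)$ be a multiplicative Hom-Akivis algebra. Then, for each integer $n \geq 0$, the $n$th derived Hom-algebra $\mathcal{A}^{(n)} := (A, [\,,\,]^{(n)}, [\,,\,,\,]^{(n)}, \alpha^{2^n})$, where $[x,y]^{(n)} := \alpha^{2^n-1}([x,y])$ and $[x,y,z]^{(n)} := \alpha^{2^{n+1}-2}([x,y,z])$ for all $x,y,z \in A$, is a multiplicative Hom-Akivis algebra.
   Context: All vector spaces are over a fixed ground field of characteristic $0$. For a linear self-map $\alpha$, $\alpha^k$ denotes the $k$-fold composition, with $\alpha^0=\mathrm{Id}$. The symbol $\circlearrowleft_{x,y,z}$ denotes the sum over cyclic permutations of $x,y,z$. A Hom-Akivis algebra is a quadruple $(A, [\,,\,], [\,,\,,\,], \alpha)$ consisting of a vector space $A$, a skew-symmetric bilinear map $[\,,\,] : A^{\otimes 2} \to A$, a trilinear map $[\,,\,,\,] : A^{\otimes 3} \to A$ and a linear map $\alpha : A \to A$ such that for all $x,y,z \in A$ $$\circlearrowleft_{x,y,z} [[x,y], \alpha(z)] = \circlearrowleft_{x,y,z} [x,y,z] - \circlearrowleft_{x,y,z} [y,x,z].$$ It is called multiplicative if $\alpha([x,y]) = [\alpha(x),\alpha(y)]$ and $\alpha([x,y,z]) = [\alpha(x),\alpha(y),\alpha(z)]$ for all $x,y,z \in A$. *)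

theory Defs
  imports Complex_Main
begin

definition bilinear_map :: "('k::field \<Rightarrow> 'a::ab_group_add \<Rightarrow> 'a) \<Rightarrow> ('a \<Rightarrow> 'a \<Rightarrow> 'a) \<Rightarrow> bool"
  where "bilinear_map scale f \<longleftrightarrow>
    (\<forall>y. Vector_Spaces.linear scale scale (\<lambda>x. f x y)) \<and>
    (\<forall>x. Vector_Spaces.linear scale scale (\<lambda>y. f x y))"

definition trilinear_map :: "('k::field \<Rightarrow> 'a::ab_group_add \<Rightarrow> 'a) \<Rightarrow> ('a \<Rightarrow> 'a \<Rightarrow> 'a \<Rightarrow> 'a) \<Rightarrow> bool"
  where "trilinear_map scale f \<longleftrightarrow>
    (\<forall>y z. Vector_Spaces.linear scale scale (\<lambda>x. f x y z)) \<and>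
    (\<forall>x z. Vector_Spaces.linear scale scale (\<lambda>y. f x y z)) \<and>
    (\<forall>x y. Vector_Spaces.linear scale scale (\<lambda>z. f x y z))"

definition cyclic_sum :: "('a \<Rightarrow> 'a \<Rightarrow> 'a \<Rightarrow> 'b::ab_group_add) \<Rightarrow> 'a \<Rightarrow> 'a \<Rightarrow> 'a \<Rightarrow> 'b"
  where "cyclic_sum f x y z = f x y z + f y z x + f z x y"

text \<open>
  The underlying vector space is the whole type \<open>'a\<close> with scalar multiplication \<open>scale\<close>
  over the field \<open>'k\<close> of characteristic 0; multilinear maps stand for linear maps on tensor powers.
\<close>

locale hom_akivis_algebra = vector_space scale
  for scale :: "'k::field_char_0 \<Rightarrow> 'a::ab_group_add \<Rightarrow> 'a" +
  fixes bracket :: "'a \<Rightarrow> 'a \<Rightarrow> 'a"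
    and triple :: "'a \<Rightarrow> 'a \<Rightarrow> 'a \<Rightarrow> 'a"
    and \<alpha> :: "'a \<Rightarrow> 'a"
  assumes bracket_bilinear: "bilinear_map scale bracket"
    and bracket_skew: "bracket x y = - bracket y x"
    and triple_trilinear: "trilinear_map scale triple"
    and twist_linear: "Vector_Spaces.linear scale scale \<alpha>"
    and hom_akivis_identity:
      "cyclic_sum (\<lambda>x y z. bracket (bracket x y) (\<alpha> z)) x y z =
       cyclic_sum (\<lambda>x y z. triple x y z) x y z - cyclic_sum (\<lambda>x y z. triple y x z) x y z"

locale multiplicative_hom_akivis_algebra = hom_akivis_algebra +
  assumes twist_bracket: "\<alpha> (bracket x y) = bracket (\<alpha> x) (\<alpha> y)"
    and twist_triple: "\<alpha> (triple x y z) = triple (\<alpha> x) (\<alpha> y) (\<alpha> z)"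

definition derived_bracket :: "('a \<Rightarrow> 'a) \<Rightarrow> nat \<Rightarrow> ('a \<Rightarrow> 'a \<Rightarrow> 'a) \<Rightarrow> 'a \<Rightarrow> 'a \<Rightarrow> 'a"
  where "derived_bracket \<alpha> n bracket x y = (\<alpha> ^^ (2 ^ n - 1)) (bracket x y)"

definition derived_triple :: "('a \<Rightarrow> 'a) \<Rightarrow> nat \<Rightarrow> ('a \<Rightarrow> 'a \<Rightarrow> 'a \<Rightarrow> 'a) \<Rightarrow> 'a \<Rightarrow> 'a \<Rightarrow> 'a \<Rightarrow> 'a"
  where "derived_triple \<alpha> n triple x y z = (\<alpha> ^^ (2 ^ (n + 1) - 2)) (triple x y z)"

definition derived_twist :: "('a \<Rightarrow> 'a) \<Rightarrow> nat \<Rightarrow> 'a \<Rightarrow> 'a"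
  where "derived_twist \<alpha> n = \<alpha> ^^ (2 ^ n)"

end

theory Submission
  imports Defs
begin

text \<open>
  The derived operations are instances of one construction with a free exponent \<open>k\<close>: apply
  \<open>\<beta> = \<alpha>\<^sup>k\<close> to the bracket, \<open>\<beta>\<^sup>2\<close> to the triple product, and take \<open>\<beta> \<circ> \<alpha>\<close> as twist.
  Multiplicativity makes \<open>\<beta>\<close> an endomorphism commuting with \<open>\<alpha>\<close>, so two nested brackets
  release two copies of \<open>\<beta>\<close>:
  \<open>\<beta> [\<beta> [x, y], \<beta> (\<alpha> z)] = \<beta>\<^sup>2 [[x, y], \<alpha> z]\<close>.
  Both sides of the Hom-Akivis identity are therefore images under the linear map \<open>\<beta>\<^sup>2\<close> of the
  original ones, which is why the triple product needs twice the exponent of the bracket.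
  The \<open>n\<close>th derived algebra is the case \<open>k = 2 ^ n - 1\<close>, since then \<open>2 * k = 2 ^ (n + 1) - 2\<close>
  and \<open>k + 1 = 2 ^ n\<close>.
\<close>

lemma bilinear_map_compose:
  assumes "Vector_Spaces.linear scale scale g" and "bilinear_map scale f"
  shows "bilinear_map scale (\<lambda>x y. g (f x y))"
  using assms Vector_Spaces.linear_compose[of scale scale _ scale g]
  unfolding bilinear_map_def comp_def by blast

lemma trilinear_map_compose:
  assumes "Vector_Spaces.linear scale scale g" and "trilinear_map scale f"
  shows "trilinear_map scale (\<lambda>x y z. g (f x y z))"
  using assms Vector_Spaces.linear_compose[of scale scale _ scale g]
  unfolding trilinear_map_def comp_def by blast

lemma (in vector_space) linear_funpow:
  assumes "Vector_Spaces.linear scale scale f"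
  shows "Vector_Spaces.linear scale scale (f ^^ k)"
proof (induction k)
  case 0
  show ?case unfolding funpow.simps by (rule linear_id)
next
  case (Suc k)
  then show ?case
    unfolding funpow.simps by (rule Vector_Spaces.linear_compose[OF _ assms])
qed

lemma (in hom_akivis_algebra) funpow_linear_simps:
  shows "(\<alpha> ^^ k) (x + y) = (\<alpha> ^^ k) x + (\<alpha> ^^ k) y"
    and "(\<alpha> ^^ k) (x - y) = (\<alpha> ^^ k) x - (\<alpha> ^^ k) y"
    and "(\<alpha> ^^ k) (- x) = - (\<alpha> ^^ k) x"
proof -
  interpret pow: Vector_Spaces.linear scale scale "\<alpha> ^^ k"
    by (rule linear_funpow[OF twist_linear])
  show "(\<alpha> ^^ k) (x + y) = (\<alpha> ^^ k) x + (\<alpha> ^^ k) y"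
    and "(\<alpha> ^^ k) (x - y) = (\<alpha> ^^ k) x - (\<alpha> ^^ k) y"
    and "(\<alpha> ^^ k) (- x) = - (\<alpha> ^^ k) x"
    by (rule pow.add pow.diff pow.neg)+
qed

context multiplicative_hom_akivis_algebra
begin

lemma funpow_bracket: "(\<alpha> ^^ k) (bracket x y) = bracket ((\<alpha> ^^ k) x) ((\<alpha> ^^ k) y)"
  by (induction k) (simp_all add: twist_bracket)

lemma funpow_triple:
  "(\<alpha> ^^ k) (triple x y z) = triple ((\<alpha> ^^ k) x) ((\<alpha> ^^ k) y) ((\<alpha> ^^ k) z)"
  by (induction k) (simp_all add: twist_triple)

lemma twisted_nested_bracket:
  "(\<alpha> ^^ k) (bracket ((\<alpha> ^^ k) (bracket x y)) ((\<alpha> ^^ (k + 1)) z)) =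
   (\<alpha> ^^ (2 * k)) (bracket (bracket x y) (\<alpha> z))"
proof -
  have "(\<alpha> ^^ (k + 1)) z = (\<alpha> ^^ k) (\<alpha> z)"
    by (simp add: funpow_swap1)
  then have "bracket ((\<alpha> ^^ k) (bracket x y)) ((\<alpha> ^^ (k + 1)) z) =
      (\<alpha> ^^ k) (bracket (bracket x y) (\<alpha> z))"
    by (simp only: funpow_bracket)
  then show ?thesis
    by (simp only: mult_2 funpow_add comp_apply)
qed

text \<open>
  Allowing every exponent, rather than only those of the form \<open>2 ^ n - 1\<close>, replaces an induction
  on \<open>n\<close> (deriving the algebra repeatedly) by a single computation.
\<close>

theorem twist_by_power:
  "multiplicative_hom_akivis_algebra scale
     (\<lambda>x y. (\<alpha> ^^ k) (bracket x y)) (\<lambda>x y z. (\<alpha> ^^ (2 * k)) (triple x y z)) (\<alpha> ^^ (k + 1))"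
proof (intro multiplicative_hom_akivis_algebra.intro hom_akivis_algebra.intro
    multiplicative_hom_akivis_algebra_axioms.intro hom_akivis_algebra_axioms.intro)
  show "vector_space scale"
    by (rule vector_space_axioms)
  show "bilinear_map scale (\<lambda>x y. (\<alpha> ^^ k) (bracket x y))"
    by (rule bilinear_map_compose[OF linear_funpow[OF twist_linear] bracket_bilinear])
  show "trilinear_map scale (\<lambda>x y z. (\<alpha> ^^ (2 * k)) (triple x y z))"
    by (rule trilinear_map_compose[OF linear_funpow[OF twist_linear] triple_trilinear])
  show "Vector_Spaces.linear scale scale (\<alpha> ^^ (k + 1))"
    by (rule linear_funpow[OF twist_linear])
next
  fix x y
  show "(\<alpha> ^^ k) (bracket x y) = - (\<alpha> ^^ k) (bracket y x)"
    by (subst bracket_skew) (rule funpow_linear_simps(3))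
next
  fix x y z
  show "cyclic_sum (\<lambda>x y z. (\<alpha> ^^ k) (bracket ((\<alpha> ^^ k) (bracket x y)) ((\<alpha> ^^ (k + 1)) z))) x y z =
      cyclic_sum (\<lambda>x y z. (\<alpha> ^^ (2 * k)) (triple x y z)) x y z -
      cyclic_sum (\<lambda>x y z. (\<alpha> ^^ (2 * k)) (triple y x z)) x y z"
    using arg_cong[OF hom_akivis_identity[of x y z], of "\<alpha> ^^ (2 * k)"]
    unfolding twisted_nested_bracket cyclic_sum_def funpow_linear_simps .
next
  have commute: "(\<alpha> ^^ i) ((\<alpha> ^^ j) u) = (\<alpha> ^^ j) ((\<alpha> ^^ i) u)" for i j u
    by (metis add.commute comp_apply funpow_add)
  fix x y z
  show "(\<alpha> ^^ (k + 1)) ((\<alpha> ^^ k) (bracket x y)) =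
      (\<alpha> ^^ k) (bracket ((\<alpha> ^^ (k + 1)) x) ((\<alpha> ^^ (k + 1)) y))"
    unfolding commute[of "k + 1" k] by (simp only: funpow_bracket[of "k + 1"])
  show "(\<alpha> ^^ (k + 1)) ((\<alpha> ^^ (2 * k)) (triple x y z)) =
      (\<alpha> ^^ (2 * k)) (triple ((\<alpha> ^^ (k + 1)) x) ((\<alpha> ^^ (k + 1)) y) ((\<alpha> ^^ (k + 1)) z))"
    unfolding commute[of "k + 1" "2 * k"] by (simp only: funpow_triple[of "k + 1"])
qed

end

theorem theorem2p7:
  fixes scale :: "'k::field_char_0 \<Rightarrow> 'a::ab_group_add \<Rightarrow> 'a"
    and bracket :: "'a \<Rightarrow> 'a \<Rightarrow> 'a"
    and triple :: "'a \<Rightarrow> 'a \<Rightarrow> 'a \<Rightarrow> 'a"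
    and \<alpha> :: "'a \<Rightarrow> 'a"
    and n :: nat
  assumes "multiplicative_hom_akivis_algebra scale bracket triple \<alpha>"
  shows "multiplicative_hom_akivis_algebra scale
           (derived_bracket \<alpha> n bracket) (derived_triple \<alpha> n triple) (derived_twist \<alpha> n)"
proof -
  let ?k = "2 ^ n - 1 :: nat"
  have "derived_bracket \<alpha> n bracket = (\<lambda>x y. (\<alpha> ^^ ?k) (bracket x y))"
    by (intro ext) (rule derived_bracket_def)
  moreover have "2 ^ (n + 1) - 2 = 2 * ?k"
    by (simp add: diff_mult_distrib2)
  then have "derived_triple \<alpha> n triple = (\<lambda>x y z. (\<alpha> ^^ (2 * ?k)) (triple x y z))"
    by (intro ext) (simp only: derived_triple_def)
  moreover have "2 ^ n = ?k + 1"
    by simp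
  then have "derived_twist \<alpha> n = \<alpha> ^^ (?k + 1)"
    by (simp only: derived_twist_def)
  ultimately show ?thesis
    using multiplicative_hom_akivis_algebra.twist_by_power[OF assms, of ?k] by (simp only:)
qed

end
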